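(* Let $\mathbf d=(d_1,\ldots,d_t)$ be a nonincreasing graphic sequence with $d_1=D>0$, and let $\mathbf d'$ be its Havel--Hakimi reduction. Then \[ \operatorname{CW}(\mathbf d')-\operatorname{CW}(\mathbf d)=\sum_{i=2}^{D+1}\frac{1}{d_i(d_i+1)}-\frac{1}{D+1}\ \ge\ 0 . \] Moreover, \[ \operatorname{CW}(\mathbf d')-\operatorname{CW}(\mathbf d)=\sum_{i=2}^{D+1}\frac{(D-d_i)(D+d_i+1)}{d_i(d_i+1)D(D+1)} . \] Consequently, if $\mathbf d^{(0)}=\mathbf d,\mathbf d^{(1)},\ldots,\mathbf d^{(s)}$ is the complete Havel--Hakimi trajectory of $\mathbf d$, with $\mathbf d^{(s)}$ consisting of $\operatorname{R}(\mathbf d)$ zeros, then \[ \operatorname{R}(\mathbf d)-\operatorname{CW}(\mathbf d)=\sum_{j=0}^{s-1}\left(\sum_{i=2}^{D_j+1}\frac{1}{d_i^{(j)}(d_i^{(j)}+1)}-\frac{1}{D_j+1}\right), \] where $D_j=d_1^{(j)}$.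
   Context: A finite sequence of nonnegative integers is graphic if it is the degree sequence of a finite simple graph. For a nonincreasing graphic sequence $\mathbf d=(d_1,\ldots,d_t)$ with $d_1=D>0$, its Havel--Hakimi reduction $\mathbf d'$ is obtained by deleting $d_1=D$ (the pivot), subtracting one from each of $d_2,\ldots,d_{D+1}$ (the selected entries, which are positive by graphicality), and reordering in nonincreasing order; $\mathbf d'$ is again graphic. Repeated reduction while the largest term is positive gives the complete trajectory $\mathbf d^{(0)},\ldots,\mathbf d^{(s)}$, ending at an all-zero sequence $\mathbf d^{(s)}$; $\operatorname{R}(\mathbf d)$ is the number of its zeros. The Caro--Wei sum is $\operatorname{CW}(\mathbf d)=\sum_i \frac{1}{d_i+1}$. *)

theory Defs
  imports Complex_Main
begin

definition simple_graph :: "'v set \<Rightarrow> 'v set set \<Rightarrow> bool" where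
  "simple_graph V E \<longleftrightarrow> finite V \<and> (\<forall>e\<in>E. e \<subseteq> V \<and> card e = 2)"

definition vertex_degree :: "'v set set \<Rightarrow> 'v \<Rightarrow> nat" where
  "vertex_degree E v = card {e \<in> E. v \<in> e}"

text \<open>
  The list \<open>vs\<close> enumerates the vertices without repetition. Taking natural numbers as vertices
  loses no generality, since every finite graph is isomorphic to one whose vertices are natural
  numbers.
\<close>

definition graphic :: "nat list \<Rightarrow> bool" where
  "graphic d \<longleftrightarrow>
    (\<exists>(V :: nat set) E vs. simple_graph V E \<and> distinct vs \<and> set vs = V \<and>
       d = map (vertex_degree E) vs)"

text \<open>
  Sequences are lists, so the \<open>i\<close>-th entry (counted from 1) of \<open>d\<close> is \<open>d ! (i - 1)\<close>.
  In the reduction of a nonincreasing graphic sequence the selected entries \<open>take D ds\<close> are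
  \<open>D\<close> many and all positive, so neither \<open>take\<close> nor the subtraction on natural numbers truncates.
\<close>

fun hh_reduction :: "nat list \<Rightarrow> nat list" where
  "hh_reduction [] = []"
| "hh_reduction (D # ds) = rev (sort (map (\<lambda>x. x - 1) (take D ds) @ drop D ds))"

lemma length_hh_reduction [simp]: "length (hh_reduction d) = length d - 1"
  by (cases d) auto

text \<open>
  The complete trajectory as a list, whose length is one more than the number of reductions.
  The head of a nonincreasing sequence is its largest term.
\<close>

fun hh_trajectory :: "nat list \<Rightarrow> nat list list" where
  "hh_trajectory [] = [[]]"
| "hh_trajectory (D # ds) =
    (if D = 0 then [D # ds] else (D # ds) # hh_trajectory (hh_reduction (D # ds)))"

definition residue :: "nat list \<Rightarrow> nat" where
  "residue d = count_list (last (hh_trajectory d)) 0"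

definition caro_wei :: "nat list \<Rightarrow> real" where
  "caro_wei d = (\<Sum>x\<leftarrow>d. 1 / (real x + 1))"

end

theory Submission
  imports Defs "HOL-Library.Multiset"
begin

text \<open>
  The trajectory stays among nonincreasing graphic sequences by the Havel--Hakimi theorem: edge
  switches at a vertex \<open>v\<close> of largest degree \<open>D\<close> make the \<open>D\<close> next largest vertices its neighbours
  without changing any degree, and then \<open>v\<close> can be deleted. In particular the selected entries are
  positive. The increment of the Caro--Wei sum is then read off from
  \<open>1/x - 1/(x + 1) = 1/(x (x + 1))\<close> and \<open>D \<cdot> 1/(D (D + 1)) = 1/(D + 1)\<close>; the increments telescope
  along the trajectory, and an all-zero sequence is as long as its Caro--Wei sum.
\<close>

section \<open>Edge switching\<close>

definition neighbours :: "'v set set \<Rightarrow> 'v \<Rightarrow> 'v set" where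
  "neighbours E v = {w. {v, w} \<in> E}"

lemma mem_neighbours [simp]: "w \<in> neighbours E v \<longleftrightarrow> {v, w} \<in> E"
  by (simp add: neighbours_def)

lemma simple_graph_no_loop: "simple_graph V E \<Longrightarrow> {v, v} \<notin> E"
  by (auto simp: simple_graph_def)

lemma neighbours_subset: "simple_graph V E \<Longrightarrow> neighbours E v \<subseteq> V - {v}"
  using simple_graph_no_loop[of V E v] by (fastforce simp: simple_graph_def)

lemma finite_neighbours: "simple_graph V E \<Longrightarrow> finite (neighbours E v)"
  using neighbours_subset[of V E v] by (auto simp: simple_graph_def intro: finite_subset)

text \<open>Each edge at \<open>v\<close> is determined by its other end. Counting ends instead of
  edges turns an edge switch into an exchange of elements in neighbourhoods.\<close>

lemma vertex_degree_eq_card_neighbours: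
  assumes "simple_graph V E"
  shows "vertex_degree E v = card (neighbours E v)"
proof -
  have "bij_betw (\<lambda>w. {v, w}) (neighbours E v) {e \<in> E. v \<in> e}"
  proof (rule bij_betw_imageI)
    show "inj_on (\<lambda>w. {v, w}) (neighbours E v)"
      by (auto simp: inj_on_def doubleton_eq_iff)
    have "\<exists>w. {v, w} \<in> E \<and> e = {v, w}" if "e \<in> E" "v \<in> e" for e
    proof -
      from assms \<open>e \<in> E\<close> obtain a b where "e = {a, b}"
        by (auto simp: simple_graph_def card_2_iff)
      with that show ?thesis by (auto simp: insert_commute)
    qed
    then show "(\<lambda>w. {v, w}) ` neighbours E v = {e \<in> E. v \<in> e}"
      by (fastforce simp: image_iff)
  qed
  then show ?thesis
    by (simp add: vertex_degree_def bij_betw_same_card)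
qed

text \<open>Each of \<open>v\<close>, \<open>a\<close>, \<open>b\<close>, \<open>c\<close> trades
  one neighbour for a new one, and all other neighbourhoods stay as they are, so no degree
  changes.\<close>

lemma switch_edges:
  assumes "simple_graph V E"
    and "{v, b} \<in> E" "{a, c} \<in> E" "{v, a} \<notin> E" "{b, c} \<notin> E" "v \<noteq> a" "b \<noteq> c"
  defines "F \<equiv> E - {{v, b}, {a, c}} \<union> {{v, a}, {b, c}}"
  shows "simple_graph V F"
    and "vertex_degree F x = vertex_degree E x"
    and "neighbours F v = insert a (neighbours E v - {b})"
proof -
  have V: "v \<in> V" "a \<in> V" "b \<in> V" "c \<in> V"
    using assms(1-3) by (auto simp: simple_graph_def)
  show graph: "simple_graph V F"
    using assms(1,6,7) V by (auto simp: simple_graph_def F_def)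
  have "v \<noteq> b" "a \<noteq> c"
    using simple_graph_no_loop[OF assms(1)] assms(2,3) by auto
  \<comment> \<open>In either case of equality, one of the two edges would coincide with the
    non-edge \<open>{v, a}\<close>.\<close>
  moreover have "v \<noteq> c" "a \<noteq> b"
    using assms(2-5) by (auto simp: insert_commute)
  ultimately have distinct: "v \<noteq> a" "v \<noteq> b" "v \<noteq> c" "a \<noteq> b" "a \<noteq> c" "b \<noteq> c"
    using assms(6,7) by auto
  show Nv: "neighbours F v = insert a (neighbours E v - {b})"
    using distinct by (auto simp: F_def doubleton_eq_iff)
  have Na: "neighbours F a = insert v (neighbours E a - {c})"
    and Nb: "neighbours F b = insert c (neighbours E b - {v})"
    and Nc: "neighbours F c = insert b (neighbours E c - {a})"
    using distinct by (auto simp: F_def doubleton_eq_iff)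
  have Nx: "neighbours F x = neighbours E x" if "x \<notin> {v, a, b, c}"
    using that by (auto simp: F_def doubleton_eq_iff)
  have exchange: "card (insert p (N - {q})) = card N" if "finite N" "q \<in> N" "p \<notin> N"
    for p q :: 'a and N
  proof -
    from that have "card N > 0" by (auto simp: card_gt_0_iff)
    with that show ?thesis by (simp add: card_Diff_singleton)
  qed
  note fin = finite_neighbours[OF assms(1)]
  have "card (neighbours F x) = card (neighbours E x)"
  proof (cases "x \<in> {v, a, b, c}")
    case True
    then consider "x = v" | "x = a" | "x = b" | "x = c" by blast
    then show ?thesis
      using assms(2-5) fin
      by cases (auto simp only: Nv Na Nb Nc mem_neighbours insert_commute intro!: exchange)
  qed (simp add: Nx)
  then show "vertex_degree F x = vertex_degree E x"
    by (simp add: vertex_degree_eq_card_neighbours[OF graph]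
        vertex_degree_eq_card_neighbours[OF assms(1)])
qed

text \<open>
  A vertex \<open>a\<close> of \<open>S\<close> that is not adjacent to \<open>v\<close> has at least the degree of some neighbour \<open>b\<close> of \<open>v\<close>
  outside \<open>S\<close>. As \<open>v\<close> is a neighbour of \<open>b\<close> but not of \<open>a\<close>, \<open>a\<close> has a neighbour \<open>c\<close> that \<open>b\<close> lacks.
\<close>

lemma ex_graph_with_neighbours:
  assumes "simple_graph V E" "S \<subseteq> V - {v}" "card S = vertex_degree E v"
    and "\<And>a b. a \<in> S \<Longrightarrow> b \<in> V - {v} - S \<Longrightarrow> vertex_degree E b \<le> vertex_degree E a"
  shows "\<exists>F. simple_graph V F \<and> vertex_degree F = vertex_degree E \<and> neighbours F v = S"
  using assms
proof (induction "card (S - neighbours E v)" arbitrary: E rule: less_induct)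
  case less
  note graph = \<open>simple_graph V E\<close>
  note deg = vertex_degree_eq_card_neighbours[OF graph]
  note fin = finite_neighbours[OF graph]
  have finS: "finite S"
    using less.prems(1,2) by (auto simp: simple_graph_def intro: finite_subset)
  show ?case
  proof (cases "S \<subseteq> neighbours E v")
    case True
    then have "neighbours E v = S"
      using card_subset_eq[OF fin True] less.prems(3) deg by simp
    with graph show ?thesis by blast
  next
    case False
    then obtain a where a: "a \<in> S" "{v, a} \<notin> E" by (meson mem_neighbours subsetI)
    have "\<not> neighbours E v \<subseteq> S"
      using card_subset_eq[OF finS, of "neighbours E v"] less.prems(3) deg False by auto
    then obtain b where b: "{v, b} \<in> E" "b \<notin> S" by (meson mem_neighbours subsetI)
    have "b \<in> V - {v}"
      using b(1) neighbours_subset[OF graph, of v] by (meson mem_neighbours subsetD)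
    with a b less.prems(4) have "card (neighbours E b) \<le> card (neighbours E a)"
      by (simp add: deg)
    \<comment> \<open>If \<open>a\<close> and \<open>b\<close> are adjacent, both sides lose one
      element, otherwise neither does. The removal ensures that the vertex \<open>c\<close> found
      below differs from \<open>b\<close>.\<close>
    then have le: "card (neighbours E b - {a}) \<le> card (neighbours E a - {b})"
      by (simp add: card_Diff_singleton_if insert_commute diff_le_mono)
    have "v \<in> neighbours E b - {a}" "v \<notin> neighbours E a - {b}"
      using a b less.prems(2) by (auto simp: insert_commute)
    then have "\<not> neighbours E a - {b} \<subseteq> neighbours E b - {a}"
      using card_seteq[of "neighbours E b - {a}" "neighbours E a - {b}"] le fin by (metis finite_Diff)
    then obtain c where "c \<in> neighbours E a - {b}" "c \<notin> neighbours E b - {a}"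
      by blast
    then have c: "{a, c} \<in> E" "c \<noteq> b" "{b, c} \<notin> E"
      using simple_graph_no_loop[OF graph] by auto
    define F where "F = E - {{v, b}, {a, c}} \<union> {{v, a}, {b, c}}"
    have "v \<noteq> a" using a less.prems(2) by auto
    note switch = switch_edges[OF graph b(1) c(1) a(2) c(3) \<open>v \<noteq> a\<close> c(2)[symmetric],
        folded F_def]
    have degF: "vertex_degree F = vertex_degree E"
      using switch(2) by auto
    have "a \<in> S - neighbours E v"
      using a by simp
    \<comment> \<open>The switch makes \<open>a\<close> adjacent to \<open>v\<close>, and the
      neighbour it costs, \<open>b\<close>, lies outside \<open>S\<close>.\<close>
    then have "S - neighbours F v \<subset> S - neighbours E v"
      unfolding switch(3) using b(2) by blast
    then have "card (S - neighbours F v) < card (S - neighbours E v)"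
      using finS by (simp add: psubset_card_mono)
    from less.hyps[OF this switch(1)] show ?thesis
      using less.prems(2-4) by (simp add: degF)
  qed
qed

section \<open>The reduction preserves graphicality\<close>

text \<open>The graph stays the same; only the enumeration of its vertices is rearranged by
  degree.\<close>

lemma graphic_rev_sort:
  assumes "graphic d"
  shows "graphic (rev (sort d))"
proof -
  from assms obtain V E vs where E: "simple_graph (V :: nat set) E" "distinct vs" "set vs = V"
    "d = map (vertex_degree E) vs"
    by (auto simp: graphic_def)
  have "sort d = map (vertex_degree E) (sort_key (vertex_degree E) vs)"
    by (rule properties_for_sort) (simp_all add: E)
  with E show ?thesis
    unfolding graphic_def
    by (intro exI[of _ V] exI[of _ E] exI[of _ "rev (sort_key (vertex_degree E) vs)"])
      (simp add: rev_map)
qed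

text \<open>The graph is rebuilt so that the pivot vertex \<open>v\<close> is adjacent to exactly
  the vertices \<open>S\<close> of the selected entries. These then have positive degree, and
  deleting \<open>v\<close> lowers precisely their degrees, each by one.\<close>

lemma graphic_Cons_decreasing:
  assumes "graphic (D # ds)" "sorted_wrt (\<ge>) (D # ds)"
  shows "D \<le> length ds"
    and "\<forall>x\<in>set (take D ds). 0 < x"
    and "graphic (map (\<lambda>x. x - 1) (take D ds) @ drop D ds)"
proof -
  from assms(1) obtain V E v ws where E: "simple_graph (V :: nat set) E"
    and vs: "distinct (v # ws)" "set (v # ws) = V"
    and D: "D = vertex_degree E v" and ds: "ds = map (vertex_degree E) ws"
    unfolding graphic_def by (auto simp: Cons_eq_map_conv)
  have "neighbours E v \<subseteq> set ws"
    using neighbours_subset[OF E, of v] vs by auto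
  then have "D \<le> card (set ws)"
    by (simp add: D vertex_degree_eq_card_neighbours[OF E] card_mono)
  then show len: "D \<le> length ds"
    using vs by (simp add: ds distinct_card)
  define S where "S = set (take D ws)"
  have disj: "S \<inter> set (drop D ws) = {}"
    unfolding S_def using vs by (intro set_take_disj_set_drop_if_distinct) auto
  have ws: "set ws = S \<union> set (drop D ws)"
    unfolding S_def by (metis append_take_drop_id set_append)
  have "sorted_wrt (\<ge>) (take D ds @ drop D ds)"
    using assms(2) by simp
  then have "y \<le> x" if "x \<in> set (take D ds)" "y \<in> set (drop D ds)" for x y
    using that unfolding sorted_wrt_append by blast
  then have le: "vertex_degree E b \<le> vertex_degree E a" if "a \<in> S" "b \<in> set (drop D ws)" for a b
    using that by (simp add: ds take_map drop_map S_def)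
  have "card S = D"
    using len vs by (simp add: S_def distinct_card ds)
  moreover have "S \<subseteq> V - {v}" "V - {v} - S \<subseteq> set (drop D ws)"
    using vs ws by auto
  ultimately obtain F where F: "simple_graph V F" "vertex_degree F = vertex_degree E"
    "neighbours F v = S"
    using ex_graph_with_neighbours[OF E, of S v] le unfolding D by blast
  note degF = vertex_degree_eq_card_neighbours[OF F(1)]
  have S_iff: "{x, v} \<in> F \<longleftrightarrow> x \<in> S" for x
    using F(3) by (auto simp: insert_commute)
  \<comment> \<open>In \<open>F\<close> the vertex \<open>v\<close> is a neighbour of
    \<open>a\<close>; this bounds the original entry too, since \<open>F\<close> and
    \<open>E\<close> have the same degrees.\<close>
  have "0 < vertex_degree F a" if "a \<in> S" for a
    using that S_iff[of a] finite_neighbours[OF F(1), of a] by (auto simp: degF card_gt_0_iff)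
  then show "\<forall>x\<in>set (take D ds). 0 < x"
    by (auto simp: ds take_map S_def F(2))
  define G where "G = {e \<in> F. v \<notin> e}"
  have G: "simple_graph (set ws) G"
    using F(1) vs by (auto simp: simple_graph_def G_def)
  have "neighbours G x = neighbours F x - {v}" if "x \<noteq> v" for x
    using that by (auto simp: G_def)
  then have degG: "vertex_degree G x = vertex_degree E x - (if x \<in> S then 1 else 0)" if "x \<noteq> v" for x
    using that S_iff[of x] unfolding F(2)[symmetric] degF vertex_degree_eq_card_neighbours[OF G]
    by (simp add: card_Diff_singleton_if)
  have "vertex_degree G x = vertex_degree E x - 1" if "x \<in> S" for x
    using that degG[of x] ws vs by auto
  then have take: "map (\<lambda>x. x - 1) (take D ds) = map (vertex_degree G) (take D ws)"
    by (simp add: ds take_map S_def)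
  have "vertex_degree G x = vertex_degree E x" if "x \<in> set (drop D ws)" for x
  proof -
    from that disj ws vs have "x \<notin> S" "x \<noteq> v" by auto
    then show ?thesis by (simp add: degG)
  qed
  then have drop: "drop D ds = map (vertex_degree G) (drop D ws)"
    by (simp add: ds drop_map)
  have "map (\<lambda>x. x - 1) (take D ds) @ drop D ds = map (vertex_degree G) ws"
    unfolding take drop by (metis append_take_drop_id map_append)
  with G vs(1) show "graphic (map (\<lambda>x. x - 1) (take D ds) @ drop D ds)"
    unfolding graphic_def by (intro exI[of _ "set ws"] exI[of _ G] exI[of _ ws]) auto
qed

lemma graphic_hh_reduction:
  assumes "graphic d" "sorted_wrt (\<ge>) d"
  shows "graphic (hh_reduction d)"
  using assms
  by (cases d) (simp_all only: hh_reduction.simps graphic_Cons_decreasing(3) graphic_rev_sort)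

lemma sorted_wrt_hh_reduction: "sorted_wrt (\<ge>) (hh_reduction d)"
  by (cases d) (simp_all add: sorted_wrt_rev)

section \<open>The Caro--Wei sum\<close>

text \<open>The sum depends only on the multiset of entries.\<close>

lemma caro_wei_rev_sort: "caro_wei (rev (sort d)) = caro_wei d"
proof -
  have "caro_wei d = (\<Sum>x\<in>#mset d. 1 / (real x + 1))" for d
    by (simp add: caro_wei_def flip: sum_mset_sum_list)
  then show ?thesis by simp
qed

lemma caro_wei_append: "caro_wei (xs @ ys) = caro_wei xs + caro_wei ys"
  by (simp add: caro_wei_def)

lemma caro_wei_decrement:
  assumes "\<forall>x\<in>set xs. 0 < x"
  shows "caro_wei (map (\<lambda>x. x - 1) xs) - caro_wei xs
    = (\<Sum>x\<leftarrow>xs. 1 / (real x * (real x + 1)))"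
  using assms
proof (induction xs)
  case (Cons x xs)
  then have "1 / (real (x - 1) + 1) - 1 / (real x + 1) = 1 / (real x * (real x + 1))"
    by (simp add: of_nat_diff field_simps)
  with Cons show ?case by (simp add: caro_wei_def)
qed (simp add: caro_wei_def)

lemma caro_wei_replicate_0: "caro_wei (replicate n 0) = real n"
  by (simp add: caro_wei_def sum_list_replicate)

text \<open>The index \<open>i\<close> corresponds to position \<open>i - 2\<close> in
  \<open>ds\<close>: one shift for counting from 1, one for the pivot.\<close>

lemma sum_selected_entries:
  assumes "D \<le> length ds"
  shows "(\<Sum>i = 2..D + 1. f ((D # ds) ! (i - 1))) = (\<Sum>x\<leftarrow>take D ds. f x)"
proof -
  have "(\<Sum>i = 2..D + 1. f ((D # ds) ! (i - 1))) = (\<Sum>i = 0..<D. f (ds ! i))"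
    by (rule sum.reindex_bij_witness[of _ "\<lambda>i. i + 2" "\<lambda>i. i - 2"])
      (auto simp: nth_Cons' numeral_2_eq_2)
  also have "\<dots> = (\<Sum>x\<leftarrow>take D ds. f x)"
    using assms by (simp add: sum_list_sum_nth)
  finally show ?thesis .
qed

text \<open>The pivot is read off as \<open>d ! 0\<close>, so that the same expression applies to
  every member of a trajectory. Being an abbreviation, it is literally the expression of the final
  statement.\<close>

abbreviation hh_increment :: "nat list \<Rightarrow> real" where
  "hh_increment d \<equiv> (\<Sum>i = 2..d ! 0 + 1. 1 / (real (d ! (i - 1)) * (real (d ! (i - 1)) + 1)))
     - 1 / (real (d ! 0) + 1)"

lemma caro_wei_hh_reduction:
  assumes "graphic d" "sorted_wrt (\<ge>) d" "d \<noteq> []"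
  shows "caro_wei (hh_reduction d) - caro_wei d = hh_increment d"
proof -
  from \<open>d \<noteq> []\<close> obtain D ds where d: "d = D # ds" by (cases d) auto
  note facts = graphic_Cons_decreasing[OF assms(1,2)[unfolded d]]
  have "caro_wei (D # ds) = 1 / (real D + 1) + caro_wei (take D ds) + caro_wei (drop D ds)"
    using caro_wei_append[of "take D ds" "drop D ds"] by (simp add: caro_wei_def)
  with caro_wei_decrement[OF facts(2)] show ?thesis
    using sum_selected_entries[OF facts(1), of "\<lambda>x. 1 / (real x * (real x + 1))"]
    by (simp add: d caro_wei_rev_sort caro_wei_append)
qed

text \<open>The term \<open>1 / (D + 1)\<close> is split into \<open>D\<close> equal shares
  \<open>1 / (D * (D + 1))\<close>, one for each selected entry \<open>x\<close>. Since
  \<open>D * (D + 1) - x * (x + 1) = (D - x) * (D + x + 1)\<close>, each difference is a term of the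
  second sum, and it is nonnegative because \<open>0 < x \<le> D\<close>.\<close>

lemma hh_increment_eq:
  assumes "graphic d" "sorted_wrt (\<ge>) d" "d \<noteq> []" "0 < d ! 0"
  shows "hh_increment d
    = (\<Sum>i = 2..d ! 0 + 1. (real (d ! 0) - real (d ! (i - 1))) * (real (d ! 0) + real (d ! (i - 1)) + 1)
        / (real (d ! (i - 1)) * (real (d ! (i - 1)) + 1) * real (d ! 0) * (real (d ! 0) + 1)))"
    and "0 \<le> hh_increment d"
proof -
  from \<open>d \<noteq> []\<close> obtain D ds where d: "d = D # ds" by (cases d) auto
  with \<open>0 < d ! 0\<close> have "0 < D" by simp
  note facts = graphic_Cons_decreasing[OF assms(1,2)[unfolded d]]
  let ?t = "\<lambda>x. (real D - real x) * (real D + real x + 1)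
    / (real x * (real x + 1) * real D * (real D + 1))"
  have t: "?t (d ! (i - 1)) = 1 / (real (d ! (i - 1)) * (real (d ! (i - 1)) + 1))
        - 1 / (real D * (real D + 1))" (is "_ = ?r (d ! (i - 1))")
    and t_nonneg: "0 \<le> ?t (d ! (i - 1))" if "i \<in> {2..D + 1}" for i
  proof -
    define x where "x = d ! (i - 1)"
    \<comment> \<open>This places \<open>x\<close> among the selected entries, whose positivity is
      known.\<close>
    have "x = ds ! (i - 2)"
      using that by (simp add: x_def d nth_Cons' numeral_2_eq_2)
    moreover have "i - 2 < length (take D ds)" "take D ds ! (i - 2) = ds ! (i - 2)"
      using that facts(1) by auto
    ultimately have x: "x \<in> set (take D ds)"
      by (metis nth_mem)
    then have "x \<in> set ds" by (rule in_set_takeD)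
    with x have "0 < x" "x \<le> D"
      using facts(2) assms(2) d by auto
    then show "?t (d ! (i - 1)) = ?r (d ! (i - 1))" and "0 \<le> ?t (d ! (i - 1))"
      unfolding x_def[symmetric] using \<open>0 < D\<close> by (simp_all add: divide_simps, simp add: algebra_simps)
  qed
  have "(\<Sum>i = 2..D + 1. 1 / (real D * (real D + 1))) = 1 / (real D + 1)"
    using \<open>0 < D\<close> by simp
  moreover have "(\<Sum>i = 2..D + 1. ?t (d ! (i - 1)))
      = (\<Sum>i = 2..D + 1. 1 / (real (d ! (i - 1)) * (real (d ! (i - 1)) + 1))
          - 1 / (real D * (real D + 1)))"
    by (rule sum.cong[OF refl]) (rule t)
  ultimately have eq: "(\<Sum>i = 2..D + 1. ?t (d ! (i - 1))) = hh_increment d"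
    unfolding sum_subtractf by (simp add: d)
  then show "hh_increment d
    = (\<Sum>i = 2..d ! 0 + 1. (real (d ! 0) - real (d ! (i - 1))) * (real (d ! 0) + real (d ! (i - 1)) + 1)
        / (real (d ! (i - 1)) * (real (d ! (i - 1)) + 1) * real (d ! 0) * (real (d ! 0) + 1)))"
    by (simp add: d)
  show "0 \<le> hh_increment d"
    unfolding eq[symmetric] by (rule sum_nonneg) (rule t_nonneg)
qed

section \<open>The complete trajectory\<close>

lemma hh_trajectory_not_Nil [simp]: "hh_trajectory d \<noteq> []"
  by (cases d) auto

text \<open>The trajectory stops when the head is 0; as the list is nonincreasing, all its entries
  are then 0.\<close>

lemma last_hh_trajectory:
  assumes "sorted_wrt (\<ge>) d"
  shows "last (hh_trajectory d) = replicate (residue d) 0"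
  using assms
proof (induction d rule: hh_trajectory.induct)
  case 1
  show ?case by (simp add: residue_def)
next
  case (2 D ds)
  show ?case
  proof (cases "D = 0")
    case True
    with "2.prems" have "D # ds = replicate (length (D # ds)) 0"
      by (intro replicate_eqI) auto
    moreover have "count_list (replicate n 0) 0 = n" for n :: nat
      by (induction n) auto
    ultimately show ?thesis
      using True by (metis hh_trajectory.simps(2) last.simps residue_def)
  next
    case False
    then show ?thesis
      using "2.IH"[OF False sorted_wrt_hh_reduction] by (simp add: residue_def)
  qed
qed

text \<open>The increments telescope to the Caro--Wei sum of the last list minus that of
  \<open>d\<close>, and on an all-zero list this sum counts the zeros. The last list is not reduced,
  hence the bound \<open>length (hh_trajectory d) - 1\<close>.\<close>

lemma residue_minus_caro_wei:
  assumes "graphic d" "sorted_wrt (\<ge>) d"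
  shows "real (residue d) - caro_wei d
    = (\<Sum>j<length (hh_trajectory d) - 1. hh_increment (hh_trajectory d ! j))"
  using assms
proof (induction d rule: hh_trajectory.induct)
  case 1
  show ?case by (simp add: residue_def caro_wei_def)
next
  case (2 D ds)
  show ?case
  proof (cases "D = 0")
    case True
    then have traj: "hh_trajectory (D # ds) = [D # ds]" by simp
    then have "D # ds = replicate (residue (D # ds)) 0"
      using last_hh_trajectory[OF "2.prems"(2)] by simp
    from arg_cong[OF this, of caro_wei] have "caro_wei (D # ds) = real (residue (D # ds))"
      by (simp only: caro_wei_replicate_0)
    then show ?thesis by (simp only: traj) simp
  next
    case False
    let ?d = "D # ds" and ?e = "hh_reduction (D # ds)"
    have traj: "hh_trajectory ?d = ?d # hh_trajectory ?e"
      using False by simp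
    then have "length (hh_trajectory ?d) - 1 = Suc (length (hh_trajectory ?e) - 1)"
      by simp
    then have "(\<Sum>j<length (hh_trajectory ?d) - 1. hh_increment (hh_trajectory ?d ! j))
        = hh_increment ?d + (\<Sum>j<length (hh_trajectory ?e) - 1. hh_increment (hh_trajectory ?e ! j))"
      by (simp only: traj sum.lessThan_Suc_shift nth_Cons_0 nth_Cons_Suc)
    also have "\<dots> = (caro_wei ?e - caro_wei ?d) + (real (residue ?e) - caro_wei ?e)"
      using "2.IH"[OF False graphic_hh_reduction[OF "2.prems"] sorted_wrt_hh_reduction]
        caro_wei_hh_reduction[OF "2.prems"] by simp
    \<comment> \<open>Both trajectories end in the same list.\<close>
    also have "residue ?e = residue ?d"
      by (simp only: residue_def traj) simp
    finally show ?thesis by simp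
  qed
qed

theorem lemma9:
  fixes d :: "nat list" and D :: nat and traj :: "nat list list" and s :: nat
  assumes "d \<noteq> []" and "sorted_wrt (\<ge>) d" and "graphic d" and "d ! 0 = D" and "D > 0"
    and "traj = hh_trajectory d" and "s = length traj - 1"
  shows "(caro_wei (hh_reduction d) - caro_wei d
           = (\<Sum>i = 2..D + 1. 1 / (real (d ! (i - 1)) * (real (d ! (i - 1)) + 1))) - 1 / (real D + 1)) \<and>
    ((\<Sum>i = 2..D + 1. 1 / (real (d ! (i - 1)) * (real (d ! (i - 1)) + 1))) - 1 / (real D + 1) \<ge> 0) \<and>
    (caro_wei (hh_reduction d) - caro_wei d
           = (\<Sum>i = 2..D + 1. (real D - real (d ! (i - 1))) * (real D + real (d ! (i - 1)) + 1)
                / (real (d ! (i - 1)) * (real (d ! (i - 1)) + 1) * real D * (real D + 1)))) \<and>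
    (traj ! s = replicate (residue d) 0) \<and>
    (real (residue d) - caro_wei d
           = (\<Sum>j<s. (\<Sum>i = 2..traj ! j ! 0 + 1.
                         1 / (real (traj ! j ! (i - 1)) * (real (traj ! j ! (i - 1)) + 1)))
                      - 1 / (real (traj ! j ! 0) + 1)))"
proof -
  have "0 < d ! 0"
    using assms(4,5) by simp
  note eq = hh_increment_eq[OF assms(3,2,1) this]
  have last: "traj ! s = last (hh_trajectory d)"
    using assms(6,7) by (simp add: last_conv_nth)
  show ?thesis
  proof (intro conjI)
    show "traj ! s = replicate (residue d) 0"
      using last last_hh_trajectory[OF assms(2)] by simp
  \<comment> \<open>The other four conjuncts are the lemmas above, with \<open>d ! 0\<close>
    rewritten to \<open>D\<close>, or with the trajectory and its number of steps folded to
    \<open>traj\<close> and \<open>s\<close>.\<close>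
  qed (fact caro_wei_hh_reduction[OF assms(3,2,1), unfolded assms(4)]
      eq(2)[unfolded assms(4)]
      caro_wei_hh_reduction[OF assms(3,2,1), unfolded eq(1), unfolded assms(4)]
      residue_minus_caro_wei[OF assms(3,2), folded assms(6), folded assms(7)])+
qed

end
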